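(* Let $\mathbb{P}$ be the unique Gibbs measure on $\Omega=\mathcal{A}^{\mathbb{Z}}$ with interaction $U\in\mathcal{U}$, let $\alpha = p(U)-\frac{p(2U)}{2}$ (which is strictly positive) and $k^*(n)=\frac{\ln n}{\alpha}$. Let $\sigma,\eta$ be independent, each with distribution $\mathbb{P}$, let $N(\sigma,\eta,n,k)$ be the number of matches with shift of length $k$, and let $\mathbb{E}_{\mathbb{P}\otimes\mathbb{P}}$ denote expectation with respect to the product measure $\mathbb{P}\otimes\mathbb{P}$. Let $\{k(n)\}_{n\in\mathbb{N}}$ be a sequence of integers. Then: 1. If $k^*(n)-k(n)\to\infty$ as $n\to\infty$, then $\lim_{n\to\infty}\mathbb{E}_{\mathbb{P}\otimes\mathbb{P}}[N(\sigma,\eta,n,k(n))]=\infty$. 2. If $k(n)-k^*(n)\to\infty$ as $n\to\infty$, then $\lim_{n\to\infty}\mathbb{E}_{\mathbb{P}\otimes\mathbb{P}}[N(\sigma,\eta,n,k(n))]=0$. 3. If $k(n)-k^*(n)$ is a bounded sequence, then $$0<\liminf_{n\to\infty}\mathbb{E}_{\mathbb{P}\otimes\mathbb{P}}(N(\sigma,\eta,n,k(n)))\le\limsup_{n\to\infty}\mathbb{E}_{\mathbb{P}\otimes\mathbb{P}}(N(\sigma,\eta,n,k(n)))<\infty.$$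
   Context: $\mathcal{A}$ is a finite set with at least two elements; $\Omega=\mathcal{A}^{\mathbb{Z}}$ with the product topology and product sigma-field; $\mathcal{S}$ is the set of (nonempty) finite subsets of $\mathbb{Z}$; for $V\subseteq\mathbb{Z}$, $\sigma_V$ is the restriction of $\sigma\in\Omega$ to $V$, $\Omega_V=\mathcal{A}^V$, and $\mathcal{F}_V$ is the sigma-field generated by $\{\sigma(i):i\in V\}$. The shift is $(\tau_i\sigma)(j)=\sigma(i+j)$. $\operatorname{diam}(A)=\max\{|i-j|:i,j\in A\}$. $C_k=\{1,\dots,k\}$. Interactions: $\mathcal{U}$ is the set of maps $U:\mathcal{S}\times\Omega\to\mathbb{R}$ such that (i) $\sigma\mapsto U(A,\sigma)$ is $\mathcal{F}_A$-measurable for all $A\in\mathcal{S}$; (ii) $U(A+i,\tau_{-i}\sigma)=U(A,\sigma)$ for all $A\in\mathcal{S}$, $i\in\mathbb{Z}$, $\sigma\in\Omega$; (iii) there is $\gamma>0$ with $\sum_{A\ni 0}e^{\gamma\operatorname{diam}(A)}\sup_{\sigma\in\Omega}|U(A,\sigma)|<\infty$. For real $q$, $(qU)(A,\sigma)=q\,U(A,\sigma)$. Gibbs measures: for $\Lambda\in\mathcal{S}$, $\zeta\in\Omega$, put $H_\Lambda^\zeta(\sigma)=\sum_{A\cap\Lambda\ne\varnothing}U(A,\sigma_\Lambda\zeta_{\Lambda^c})$, where $\sigma_\Lambda\zeta_{\Lambda^c}$ equals $\sigma$ on $\Lambda$ and $\zeta$ off $\Lambda$. A probability measure $\mathbb{P}$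 on $\Omega$ is a Gibbs measure with interaction $U$ if for all $\Lambda\in\mathcal{S}$ the conditional distribution of $\sigma_\Lambda$ given $\sigma_{\Lambda^c}=\zeta_{\Lambda^c}$ is, for $\mathbb{P}$-a.e. $\zeta$, given by the weights $e^{-H_\Lambda^\zeta(\sigma)}/\sum_{\sigma'_\Lambda\in\Omega_\Lambda}e^{-H_\Lambda^\zeta(\sigma')}$. For $U\in\mathcal{U}$ there is exactly one Gibbs measure with interaction $U$. Pressure: $p(U)=\lim_{n\to\infty}\frac1n\log\sum_{\sigma_{C_n}\in\Omega_{C_n}}\exp\bigl(-\sum_{A\subseteq C_n}U(A,\sigma)\bigr)$. Number of shift-matches for two strings: for $\sigma,\eta\in\Omega$ and integers $1\le k<n$, $N(\sigma,\eta,n,k)=\sum_{i=0}^{n-k}\sum_{j=0,\,j\ne i}^{n-k}\mathbb{1}\{(\tau_i\sigma)_{C_k}=(\tau_j\eta)_{C_k}\}$. Sequences $k(n)$ are understood to satisfy $1\le k(n)<n$ for all sufficiently large $n$, so that $N(\sigma,\eta,n,k(n))$ is defined. *)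

theory Defs
  imports "HOL-Probability.Probability"
begin

text \<open>
  The alphabet is a type \<open>'a\<close> of class \<open>finite\<close>. A configuration over
  \<open>V\<close> is an extensional function in \<open>config_on V\<close>, and the restriction of \<open>s\<close> to \<open>V\<close>
  is \<open>restrict s V\<close>. Elements of \<open>config_on V\<close> are also total functions on the integers
  (constantly \<open>undefined\<close> off \<open>V\<close>); below they are only passed to functions that depend on
  their values on \<open>V\<close> alone.
\<close>

type_synonym 'a config = "int \<Rightarrow> 'a"
type_synonym 'a interaction = "int set \<Rightarrow> 'a config \<Rightarrow> real"

definition config_space :: "'a config measure" where
  "config_space = PiM UNIV (\<lambda>_. count_space UNIV)"

definition config_on :: "int set \<Rightarrow> 'a config set" where
  "config_on V = PiE V (\<lambda>_. UNIV)"

definition config_algebra :: "int set \<Rightarrow> 'a config measure" where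
  "config_algebra V = sigma UNIV {(\<lambda>s. s i) -` B |i B. i \<in> V}"

definition finsets :: "int set set" where
  "finsets = {A. finite A \<and> A \<noteq> {}}"

definition shift :: "int \<Rightarrow> 'a config \<Rightarrow> 'a config" where
  "shift i s = (\<lambda>j. s (i + j))"

definition diam :: "int set \<Rightarrow> int" where
  "diam A = Max {\<bar>i - j\<bar> |i j. i \<in> A \<and> j \<in> A}"

definition segment :: "int \<Rightarrow> int set" where
  "segment k = {1..k}"

text \<open>
  The real supremum below is over a bounded set: by the measurability condition
  \<open>U A\<close> takes only finitely many values.
\<close>

definition interactions :: "'a::finite interaction set" where
  "interactions = {U.
     (\<forall>A\<in>finsets. U A \<in> borel_measurable (config_algebra A)) \<and>
     (\<forall>A\<in>finsets. \<forall>i s. U ((\<lambda>a. a + i) ` A) (shift (-i) s) = U A s) \<and>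
     (\<exists>\<gamma>>0. (\<lambda>A. exp (\<gamma> * real_of_int (diam A)) * (SUP s. \<bar>U A s\<bar>))
               summable_on {A \<in> finsets. 0 \<in> A})}"

definition scale :: "real \<Rightarrow> 'a interaction \<Rightarrow> 'a interaction" where
  "scale q U = (\<lambda>A s. q * U A s)"

definition glue :: "int set \<Rightarrow> 'a config \<Rightarrow> 'a config \<Rightarrow> 'a config" where
  "glue L s z = (\<lambda>i. if i \<in> L then s i else z i)"

definition hamiltonian :: "'a interaction \<Rightarrow> int set \<Rightarrow> 'a config \<Rightarrow> 'a config \<Rightarrow> real" where
  "hamiltonian U L z s = (\<Sum>\<^sub>\<infinity>A\<in>{A \<in> finsets. A \<inter> L \<noteq> {}}. U A (glue L s z))"

definition gibbs_weight ::
  "'a::finite interaction \<Rightarrow> int set \<Rightarrow> 'a config \<Rightarrow> 'a config \<Rightarrow> real" where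
  "gibbs_weight U L z s =
     exp (- hamiltonian U L z s) / (\<Sum>s'\<in>config_on L. exp (- hamiltonian U L z s'))"

text \<open>
  The conditional law of the restriction to \<open>L\<close> given the restriction to the complement of
  \<open>L\<close> lives on the finite set \<open>config_on L\<close>, so it is given by the conditional
  probabilities of the finitely many events \<open>restrict s L = x\<close>.
\<close>

definition gibbs_measure :: "'a::finite interaction \<Rightarrow> 'a config measure \<Rightarrow> bool" where
  "gibbs_measure U P \<longleftrightarrow>
     prob_space P \<and> sets P = sets config_space \<and>
     (\<forall>L\<in>finsets. AE z in P. \<forall>x\<in>config_on L.
        real_cond_exp P (config_algebra (- L)) (indicat_real {s. restrict s L = x}) z
          = gibbs_weight U L z x)"

definition pressure :: "'a::finite interaction \<Rightarrow> real" where
  "pressure U =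
     lim (\<lambda>n. 1 / real n *
       ln (\<Sum>s\<in>config_on (segment (int n)).
             exp (- (\<Sum>A\<in>{A \<in> finsets. A \<subseteq> segment (int n)}. U A s))))"

definition decay_rate :: "'a::finite interaction \<Rightarrow> real" where
  "decay_rate U = pressure U - pressure (scale 2 U) / 2"

definition critical_length :: "'a::finite interaction \<Rightarrow> nat \<Rightarrow> real" where
  "critical_length U n = ln (real n) / decay_rate U"

definition shift_matches :: "'a config \<Rightarrow> 'a config \<Rightarrow> int \<Rightarrow> int \<Rightarrow> real" where
  "shift_matches s t n k =
     (\<Sum>i\<in>{0..n - k}. \<Sum>j\<in>{0..n - k} - {i}.
        of_bool (restrict (shift i s) (segment k) = restrict (shift j t) (segment k)))"

definition expected_matches :: "'a config measure \<Rightarrow> nat \<Rightarrow> int \<Rightarrow> real" where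
  "expected_matches P n k = (\<integral>(s, t). shift_matches s t (int n) k \<partial>(P \<Otimes>\<^sub>M P))"

end

theory Submission
  imports Defs "HOL-Real_Asymp.Real_Asymp"
begin

text \<open>
  On an interval of \<open>k\<close> sites the infinite-volume Hamiltonian differs from the free one by a
  bounded boundary term, so every Gibbs measure gives each word \<open>x\<close> probability
  \<open>exp (- H x) / Z k\<close> up to a constant factor, wherever the interval lies. A fixed pair of
  windows therefore matches with probability comparable to \<open>Z\<^sub>2 k / (Z\<^sub>1 k)\<^sup>2\<close>, where
  \<open>Z\<^sub>q\<close> is the partition function of \<open>qU\<close>. The same boundary estimate makes
  \<open>ln (Z\<^sub>q k)\<close> additive up to a bounded error, hence equal to \<open>k * p(qU)\<close> up to a bounded
  error, and the expected number of matches is of order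
  \<open>(n - k + 1) * (n - k) * exp (- 2 * \<alpha> * k)\<close>.
\<close>

section \<open>Quasi-additive sequences\<close>

text \<open>Each further block of length \<open>n\<close> costs one error \<open>C\<close>. The
  extra unit in \<open>m + 1\<close> pays for the start of the induction, where only
  \<open>\<bar>a 0\<bar> \<le> C\<close> is known.\<close>

lemma quasi_additive_mult:
  fixes a :: "nat \<Rightarrow> real"
  assumes "\<And>m n. \<bar>a (m + n) - a m - a n\<bar> \<le> C"
  shows "\<bar>a (m * n) - m * a n\<bar> \<le> real (m + 1) * C"
proof (induction m)
  case 0
  show ?case using assms[of 0 0] by simp
next
  case (Suc m)
  have "\<bar>a (n + m * n) - a n - a (m * n)\<bar> \<le> C" using assms .
  with Suc show ?case by (simp add: algebra_simps abs_le_iff)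
qed

text \<open>Comparing \<open>a (m * n)\<close> with both \<open>m * a n\<close> and
  \<open>n * a m\<close> shows that \<open>a n / n\<close> is Cauchy with error of order
  \<open>C / n\<close>. Letting one index tend to infinity and multiplying by \<open>n\<close> turns
  this into an error bounded uniformly in \<open>n\<close>.\<close>

lemma quasi_additive_rate:
  fixes a :: "nat \<Rightarrow> real"
  assumes qa: "\<And>m n. \<bar>a (m + n) - a m - a n\<bar> \<le> C"
  obtains p where "(\<lambda>n. 1 / real n * a n) \<longlonglongrightarrow> p" "\<And>n. \<bar>a n - real n * p\<bar> \<le> 2 * C"
proof -
  have C: "C \<ge> 0" using qa[of 0 0] by linarith
  have *: "\<bar>1 / real (m * n) * a (m * n) - 1 / real n * a n\<bar> \<le> 2 * C / real n"
    if "m > 0" "n > 0" for m n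
  proof -
    have "1 / real (m * n) * a (m * n) - 1 / real n * a n
        = (a (m * n) - m * a n) / real (m * n)"
      using that by (simp add: field_simps)
    also have "\<bar>\<dots>\<bar> \<le> real (m + 1) * C / real (m * n)"
      using quasi_additive_mult[of a C m n, OF qa] that
      by (simp add: abs_divide divide_right_mono)
    \<comment> \<open>Using \<open>m + 1 \<le> 2 * m\<close> makes the bound uniform in
      \<open>m\<close>; this is the source of the factor 2.\<close>
    also have "\<dots> \<le> real (2 * m) * C / real (m * n)"
      using that C by (intro divide_right_mono mult_right_mono) auto
    also have "\<dots> = 2 * C / real n" using that by (simp add: field_simps)
    finally show ?thesis .
  qed
  have cauchy: "\<bar>1 / real m * a m - 1 / real n * a n\<bar> \<le> 2 * C / real m + 2 * C / real n"
    if "m > 0" "n > 0" for m n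
    using *[OF that] *[of n m] that by (simp add: mult.commute abs_le_iff)
  have "Cauchy (\<lambda>n. 1 / real n * a n)"
  proof (rule CauchyI)
    fix e :: real assume e: "e > 0"
    have "\<forall>\<^sub>F n in sequentially. 2 * C / real n < e / 2"
      using e by (intro order_tendstoD(2)[of _ 0]) (real_asymp, simp)
    then obtain N where N: "\<And>n. n \<ge> N \<Longrightarrow> 2 * C / real n < e / 2"
      by (auto simp: eventually_at_top_linorder)
    show "\<exists>M. \<forall>m\<ge>M. \<forall>n\<ge>M. norm (1 / real m * a m - 1 / real n * a n) < e"
    proof (intro exI[of _ "max N 1"] allI impI)
      fix m n assume "m \<ge> max N 1" "n \<ge> max N 1"
      then show "norm (1 / real m * a m - 1 / real n * a n) < e"
        using cauchy[of m n] N[of m] N[of n] by auto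
    qed
  qed
  then obtain p where p: "(\<lambda>n. 1 / real n * a n) \<longlonglongrightarrow> p"
    using Cauchy_convergent convergent_def by blast
  have "\<bar>a n - real n * p\<bar> \<le> 2 * C" for n
  proof (cases "n = 0")
    \<comment> \<open>Division by zero yields 0 and hides \<open>a 0\<close>, so this case uses
      \<open>\<bar>a 0\<bar> \<le> C\<close> directly.\<close>
    case True
    then show ?thesis using qa[of 0 0] C by simp
  next
    case False
    have "(\<lambda>m. \<bar>1 / real m * a m - 1 / real n * a n\<bar>) \<longlonglongrightarrow> \<bar>p - 1 / real n * a n\<bar>"
      by (intro tendsto_intros p)
    moreover have "(\<lambda>m. 2 * C / real m + 2 * C / real n) \<longlonglongrightarrow> 0 + 2 * C / real n"
      by real_asymp
    ultimately have "\<bar>p - 1 / real n * a n\<bar> \<le> 0 + 2 * C / real n"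
      by (rule LIMSEQ_le) (use cauchy False in \<open>auto intro!: exI[of _ 1]\<close>)
    then show ?thesis using False by (simp add: abs_le_iff field_simps)
  qed
  then show ?thesis using p that by blast
qed

section \<open>Configurations\<close>

lemma finite_config_on: "finite L \<Longrightarrow> finite (config_on L :: 'a::finite config set)"
  unfolding config_on_def by (simp add: finite_PiE)

lemma restrict_in_config_on: "restrict s L \<in> config_on L"
  by (simp add: config_on_def)

lemma config_on_nonempty: "config_on L \<noteq> {}"
  using restrict_in_config_on by blast

lemma shift_shift [simp]: "shift i (shift j s) = shift (i + j) s"
  by (auto simp: shift_def add.commute add.left_commute)

lemma shift_0 [simp]: "shift 0 s = s"
  by (simp add: shift_def)

lemma mem_translate_iff: "j \<in> (\<lambda>a. a + i) ` L \<longleftrightarrow> j - i \<in> L" for i j :: int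
  by (auto intro: image_eqI[of _ _ "j - i"])

lemma diam_ge:
  assumes "finite A" "i \<in> A" "j \<in> A"
  shows "\<bar>i - j\<bar> \<le> diam A"
proof -
  have "{\<bar>i - j\<bar> |i j. i \<in> A \<and> j \<in> A} = (\<lambda>(i, j). \<bar>i - j\<bar>) ` (A \<times> A)" by auto
  then show ?thesis unfolding diam_def using assms by (intro Max_ge) auto
qed

lemma diam_translate: "diam ((\<lambda>a. a + i) ` A) = diam A"
proof -
  have "{\<bar>x - y\<bar> |x y. x \<in> (\<lambda>a. a + i) ` A \<and> y \<in> (\<lambda>a. a + i) ` A} = {\<bar>x - y\<bar> |x y. x \<in> A \<and> y \<in> A}"
    unfolding image_iff by (intro Collect_cong) (metis add_diff_cancel_right)
  then show ?thesis by (simp add: diam_def)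
qed

lemma translate_in_finsets [simp]: "(\<lambda>a. a + i) ` A \<in> finsets \<longleftrightarrow> A \<in> finsets"
  by (auto simp: finsets_def dest: finite_imageD)

text \<open>The events that do not separate \<open>s\<close> from \<open>t\<close> are closed under
  complements and countable unions, and they include all generators.\<close>

lemma config_algebra_invariant:
  assumes "X \<in> sets (config_algebra A)" "\<And>a. a \<in> A \<Longrightarrow> s a = t a"
  shows "s \<in> X \<longleftrightarrow> t \<in> X"
proof -
  have "X \<in> sigma_sets UNIV {(\<lambda>s. s i) -` B |i B. i \<in> A}"
    using assms(1) by (simp add: config_algebra_def)
  then show ?thesis by (induction) (use assms(2) in auto)
qed

text \<open>The level set of \<open>f\<close> through \<open>s\<close> is an event of the algebra,
  so it cannot separate \<open>s\<close> from \<open>t\<close>. This turns the measurability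
  condition on an interaction into dependence on finitely many sites.\<close>

lemma config_algebra_measurable_local:
  fixes f :: "'a config \<Rightarrow> real"
  assumes "f \<in> borel_measurable (config_algebra A)" "\<And>a. a \<in> A \<Longrightarrow> s a = t a"
  shows "f s = f t"
proof -
  have "f -` {f s} \<inter> space (config_algebra A) \<in> sets (config_algebra A)"
    by (rule measurable_sets[OF assms(1)]) simp
  then have "s \<in> f -` {f s} \<inter> space (config_algebra A) \<longleftrightarrow> t \<in> f -` {f s} \<inter> space (config_algebra A)"
    by (rule config_algebra_invariant) (rule assms(2))
  then show ?thesis by (simp add: config_algebra_def space_measure_of_conv)
qed

text \<open>Configurations on a set are \<open>undefined\<close> off it, and the shift moves this
  pattern together with the set.\<close>

lemma bij_betw_shift_config_on:
  "bij_betw (shift (-i)) (config_on L) (config_on ((\<lambda>a. a + i) ` L) :: 'a config set)"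
proof (rule bij_betw_byWitness[where f' = "shift i"])
  have mem: "s \<in> config_on V \<longleftrightarrow> (\<forall>j. j \<notin> V \<longrightarrow> s j = undefined)" for s :: "'a config" and V
    by (auto simp: config_on_def PiE_def extensional_def)
  show "shift (-i) ` config_on L \<subseteq> (config_on ((\<lambda>a. a + i) ` L) :: 'a config set)"
    by (simp add: image_subset_iff mem mem_translate_iff shift_def)
  show "shift i ` config_on ((\<lambda>a. a + i) ` L) \<subseteq> (config_on L :: 'a config set)"
    by (simp add: image_subset_iff mem mem_translate_iff shift_def)
qed auto

text \<open>Restriction to the two pieces and gluing are mutually inverse. Off \<open>L1\<close> the
  glued map takes the values of \<open>t\<close>, so it is again \<open>undefined\<close> off the
  union.\<close>

lemma sum_config_on_union:
  fixes f :: "'a config \<Rightarrow> real"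
  assumes "L1 \<inter> L2 = {}"
  shows "(\<Sum>s\<in>config_on (L1 \<union> L2). f s) = (\<Sum>s\<in>config_on L1. \<Sum>t\<in>config_on L2. f (glue L1 s t))"
  unfolding sum.cartesian_product
proof (rule sum.reindex_bij_witness[where j = "\<lambda>s. (restrict s L1, restrict s L2)"
       and i = "\<lambda>(s, t). glue L1 s t"])
  fix s :: "'a config" assume s: "s \<in> config_on (L1 \<union> L2)"
  have "glue L1 (restrict s L1) (restrict s L2) = s"
    using s by (auto simp: config_on_def glue_def PiE_def extensional_def fun_eq_iff)
  then show "(case (restrict s L1, restrict s L2) of (s, t) \<Rightarrow> glue L1 s t) = s"
    and "(case (restrict s L1, restrict s L2) of (s, t) \<Rightarrow> f (glue L1 s t)) = f s" by simp_all
  show "(restrict s L1, restrict s L2) \<in> config_on L1 \<times> config_on L2"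
    by (simp add: restrict_in_config_on)
next
  fix p :: "'a config \<times> 'a config" assume p: "p \<in> config_on L1 \<times> config_on L2"
  obtain s t where st: "p = (s, t)" "s \<in> config_on L1" "t \<in> config_on L2" using p by auto
  have "restrict (glue L1 s t) L1 = s"
    using st by (auto simp: config_on_def glue_def PiE_def extensional_def fun_eq_iff)
  moreover have "restrict (glue L1 s t) L2 = t"
    using st assms by (auto simp: config_on_def glue_def PiE_def extensional_def fun_eq_iff)
  ultimately show "(restrict (case p of (s, t) \<Rightarrow> glue L1 s t) L1,
      restrict (case p of (s, t) \<Rightarrow> glue L1 s t) L2) = p" by (simp add: st)
  show "(case p of (s, t) \<Rightarrow> glue L1 s t) \<in> config_on (L1 \<union> L2)"
    using st by (auto simp: config_on_def glue_def PiE_def extensional_def)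
qed

section \<open>Cylinder events and coordinate algebras\<close>

lemma space_config_space [simp]: "space config_space = UNIV"
  by (simp add: config_space_def space_PiM)

lemma coordinate_vimage_sets: "(\<lambda>s. s i) -` B \<in> sets (config_space :: 'a config measure)"
proof -
  have "(\<lambda>s. s i) \<in> measurable (config_space :: 'a config measure) (count_space UNIV)"
    unfolding config_space_def by (rule measurable_component_singleton) simp
  from measurable_sets[OF this, of B] show ?thesis by simp
qed

lemma cylinder_sets:
  assumes "finite L"
  shows "{s. restrict (shift i s) L = x} \<in> sets (config_space :: 'a config measure)"
proof (cases "x \<in> config_on L")
  case True
  then have "{s. restrict (shift i s) L = x}
      = {s \<in> space config_space. \<forall>j\<in>L. s \<in> (\<lambda>s. s (i + j)) -` {x j}}"
    by (auto simp: config_on_def PiE_def extensional_def restrict_def shift_def fun_eq_iff)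
  also have "\<dots> \<in> sets config_space"
  proof (rule sets.sets_Collect_finite_All[OF _ assms])
    fix j
    show "{s \<in> space config_space. s \<in> (\<lambda>s. s (i + j)) -` {x j}} \<in> sets config_space"
      using coordinate_vimage_sets[of "i + j" "{x j}"] by (simp only: space_config_space UNIV_I simp_thms Collect_mem_eq)
  qed
  finally show ?thesis .
next
  case False
  then have "{s. restrict (shift i s) L = x} = {}" using restrict_in_config_on by blast
  then show ?thesis by simp
qed

lemma subalgebra_config_algebra:
  fixes P :: "'a config measure"
  assumes "sets P = sets config_space"
  shows "subalgebra P (config_algebra V)"
proof -
  have "space P = UNIV" using sets_eq_imp_space_eq[OF assms] by simp
  moreover have "sigma_sets (space P) {(\<lambda>s. s i) -` B |i B. i \<in> V} \<subseteq> sets P"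
    using coordinate_vimage_sets by (intro sets.sigma_sets_subset) (auto simp: assms)
  ultimately show ?thesis
    by (simp add: subalgebra_def config_algebra_def space_measure_of_conv sets_measure_of_conv)
qed

section \<open>Interactions with summable boundary energy\<close>

text \<open>Locality and an abstract translation invariant majorant \<open>b\<close> replace
  measurability and suprema. The summability condition appears as a bound on finite sums, so that
  the boundary estimates below need no infinite sums over sets.\<close>

locale decaying_interaction =
  fixes U :: "'a::finite interaction" and b :: "int set \<Rightarrow> real" and \<gamma> S :: real
  assumes U_local: "\<And>A s t. A \<in> finsets \<Longrightarrow> (\<And>a. a \<in> A \<Longrightarrow> s a = t a) \<Longrightarrow> U A s = U A t"
    and U_translate: "\<And>A i s. A \<in> finsets \<Longrightarrow> U ((\<lambda>a. a + i) ` A) (shift (-i) s) = U A s"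
    and U_bound: "\<And>A s. A \<in> finsets \<Longrightarrow> \<bar>U A s\<bar> \<le> b A"
    and b_translate: "\<And>A i. A \<in> finsets \<Longrightarrow> b ((\<lambda>a. a + i) ` A) = b A"
    and \<gamma>_pos: "\<gamma> > 0"
    and sum_0_le: "\<And>F. finite F \<Longrightarrow> F \<subseteq> {A \<in> finsets. 0 \<in> A} \<Longrightarrow>
      (\<Sum>A\<in>F. exp (\<gamma> * real_of_int (diam A)) * b A) \<le> S"

lemma interactions_decaying:
  assumes "U \<in> interactions"
  obtains b \<gamma> S where "decaying_interaction U b \<gamma> S"
proof -
  from assms obtain \<gamma> where meas: "\<And>A. A \<in> finsets \<Longrightarrow> U A \<in> borel_measurable (config_algebra A)"
    and tr: "\<And>A i s. A \<in> finsets \<Longrightarrow> U ((\<lambda>a. a + i) ` A) (shift (-i) s) = U A s"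
    and \<gamma>: "\<gamma> > 0"
    and summ: "(\<lambda>A. exp (\<gamma> * real_of_int (diam A)) * (SUP s. \<bar>U A s\<bar>))
               summable_on {A \<in> finsets. 0 \<in> A}"
    unfolding interactions_def by blast
  define b where "b = (\<lambda>A. SUP s. \<bar>U A s\<bar>)"
  have loc: "U A s = U A t" if "A \<in> finsets" "\<And>a. a \<in> A \<Longrightarrow> s a = t a" for A s t
    using config_algebra_measurable_local[OF meas] that by blast
  have bound: "\<bar>U A s\<bar> \<le> b A" if A: "A \<in> finsets" for A s
  proof -
    \<comment> \<open>Locality leaves only the finitely many values on \<open>config_on A\<close>,
      so the real supremum is a genuine upper bound.\<close>
    have "range (\<lambda>s. \<bar>U A s\<bar>) \<subseteq> (\<lambda>s. \<bar>U A s\<bar>) ` config_on A"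
    proof
      fix y assume "y \<in> range (\<lambda>s. \<bar>U A s\<bar>)"
      then obtain s where "y = \<bar>U A s\<bar>" by auto
      also have "U A s = U A (restrict s A)" by (rule loc[OF A]) auto
      finally show "y \<in> (\<lambda>s. \<bar>U A s\<bar>) ` config_on A"
        using restrict_in_config_on by blast
    qed
    moreover have "finite (config_on A :: 'a config set)"
      using A by (intro finite_config_on) (auto simp: finsets_def)
    ultimately have "finite (range (\<lambda>s. \<bar>U A s\<bar>))"
      using finite_surj by blast
    then show ?thesis unfolding b_def by (intro cSUP_upper bdd_above_finite) auto
  qed
  have btr: "b ((\<lambda>a. a + i) ` A) = b A" if A: "A \<in> finsets" for A i
  proof -
    have "range (\<lambda>s. \<bar>U ((\<lambda>a. a + i) ` A) s\<bar>) = range (\<lambda>s. \<bar>U A s\<bar>)"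
    proof safe
      fix s
      have "U ((\<lambda>a. a + i) ` A) s = U A (shift i s)"
        using tr[OF A, of i "shift i s"] by simp
      then show "\<bar>U ((\<lambda>a. a + i) ` A) s\<bar> \<in> range (\<lambda>s. \<bar>U A s\<bar>)" by auto
    next
      fix s
      show "\<bar>U A s\<bar> \<in> range (\<lambda>s. \<bar>U ((\<lambda>a. a + i) ` A) s\<bar>)"
        using tr[OF A, of i s] by (metis rangeI)
    qed
    then show ?thesis unfolding b_def by simp
  qed
  have b_nonneg: "b A \<ge> 0" if "A \<in> finsets" for A
    using bound[OF that, of undefined] by linarith
  have "(\<Sum>A\<in>F. exp (\<gamma> * real_of_int (diam A)) * b A)
      \<le> infsum (\<lambda>A. exp (\<gamma> * real_of_int (diam A)) * b A) {A \<in> finsets. 0 \<in> A}"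
    if "finite F" "F \<subseteq> {A \<in> finsets. 0 \<in> A}" for F
    using summ that by (intro finite_sum_le_infsum) (auto simp: b_nonneg, simp add: b_def)
  with loc tr bound btr \<gamma> show ?thesis by (intro that) (unfold_locales, blast+)
qed

lemma exp_between:
  fixes g h e :: real
  assumes "\<bar>h - g\<bar> \<le> e"
  shows "exp (- e) * exp (- g) \<le> exp (- h)" "exp (- h) \<le> exp e * exp (- g)"
  using assms by (auto simp: exp_add[symmetric])

section \<open>Interaction strength at a site and across a cut\<close>

context decaying_interaction
begin

lemma b_nonneg: "A \<in> finsets \<Longrightarrow> b A \<ge> 0"
  using U_bound[of A undefined] by linarith

lemma S_nonneg: "S \<ge> 0"
  using sum_0_le[of "{}"] by simp

text \<open>Translating by \<open>-i\<close> moves the site to 0 and preserves both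
  \<open>diam\<close> and \<open>b\<close>.\<close>

lemma sum_at_site_le:
  assumes F: "finite F" "F \<subseteq> {A \<in> finsets. i \<in> A}"
  shows "(\<Sum>A\<in>F. exp (\<gamma> * real_of_int (diam A)) * b A) \<le> S"
proof -
  let ?t = "\<lambda>A. (\<lambda>a. a + -i) ` A"
  have "inj ?t" by (intro inj_image_mem_iff injI) (simp add: inj_image_eq_iff inj_def)
  then have "(\<Sum>A\<in>?t ` F. exp (\<gamma> * real_of_int (diam A)) * b A)
      = (\<Sum>A\<in>F. exp (\<gamma> * real_of_int (diam (?t A))) * b (?t A))"
    by (subst sum.reindex) (auto intro: inj_on_subset)
  also have "\<dots> = (\<Sum>A\<in>F. exp (\<gamma> * real_of_int (diam A)) * b A)"
    using F by (intro sum.cong refl) (auto simp only: diam_translate b_translate)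
  finally have "(\<Sum>A\<in>?t ` F. exp (\<gamma> * real_of_int (diam A)) * b A) = \<dots>" .
  moreover have "?t ` F \<subseteq> {A \<in> finsets. 0 \<in> A}"
  proof safe
    fix A assume "A \<in> F"
    then have A: "A \<in> finsets" "i \<in> A" using F by auto
    from A(1) show "?t A \<in> finsets" by (simp only: translate_in_finsets)
    show "0 \<in> ?t A" using A(2) by (intro image_eqI[of _ _ i]) auto
  qed
  ultimately show ?thesis using sum_0_le[of "?t ` F"] F(1) by simp
qed

lemma sum_b_at_site_le:
  assumes "finite F" "F \<subseteq> {A \<in> finsets. i \<in> A}"
  shows "sum b F \<le> S"
proof -
  have "sum b F \<le> (\<Sum>A\<in>F. exp (\<gamma> * real_of_int (diam A)) * b A)"
  proof (intro sum_mono)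
    fix A assume "A \<in> F"
    with assms have A: "A \<in> finsets" "i \<in> A" by auto
    then have "diam A \<ge> 0" using diam_ge[of A i i] by (simp add: finsets_def)
    with A \<gamma>_pos show "b A \<le> exp (\<gamma> * real_of_int (diam A)) * b A"
      using mult_right_mono[of 1 "exp (\<gamma> * real_of_int (diam A))" "b A"] b_nonneg by auto
  qed
  with sum_at_site_le[OF assms] show ?thesis by simp
qed

text \<open>The geometric series with first term \<open>S\<close> and ratio
  \<open>exp (- \<gamma>)\<close>. It bounds the total interaction through the cut between two
  neighbouring sites.\<close>

definition D :: real where "D = S / (1 - exp (- \<gamma>))"

definition crossing :: "int \<Rightarrow> int set set" where
  "crossing c = {A \<in> finsets. (\<exists>a\<in>A. a \<le> c) \<and> (\<exists>a\<in>A. c < a)}"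

text \<open>Grouping the sets by their minimum \<open>m\<close>: those crossing the cut have diameter at least
  \<open>c - m\<close>, so each group contributes at most \<open>S * exp (- \<gamma> * (c - m))\<close>.\<close>

lemma sum_b_crossing_le:
  assumes F: "finite F" "F \<subseteq> crossing c"
  shows "sum b F \<le> D"
proof -
  \<comment> \<open>The truncation by \<open>nat\<close> loses nothing, since a set crossing the cut
    has its minimum at most \<open>c\<close>.\<close>
  define r where "r A = nat (c - Min A)" for A
  have Min: "Min A \<in> A" "Min A \<le> c" "real (r A) \<le> real_of_int (diam A)" if "A \<in> F" for A
  proof -
    have A: "finite A" "A \<noteq> {}" using that F by (auto simp: crossing_def finsets_def)
    from that F obtain x y where xy: "x \<in> A" "x \<le> c" "y \<in> A" "c < y" by (auto simp: crossing_def)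
    show 1: "Min A \<in> A" using A by simp
    show "Min A \<le> c" using A xy by (meson Min_le order_trans)
    with xy diam_ge[OF A(1) xy(3) 1] have "int (r A) \<le> diam A" by (simp add: r_def)
    then show "real (r A) \<le> real_of_int (diam A)" by linarith
  qed
  have "sum b F = (\<Sum>j\<in>r ` F. \<Sum>A\<in>{A \<in> F. r A = j}. b A)"
    using F by (subst sum.group) auto
  also have "\<dots> \<le> (\<Sum>j\<in>r ` F. S * exp (- \<gamma>) ^ j)"
  proof (intro sum_mono)
    fix j assume "j \<in> r ` F"
    have "(\<Sum>A\<in>{A \<in> F. r A = j}. b A)
        \<le> (\<Sum>A\<in>{A \<in> F. r A = j}. exp (- \<gamma>) ^ j * (exp (\<gamma> * real_of_int (diam A)) * b A))"
    proof (intro sum_mono)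
      fix A assume A: "A \<in> {A \<in> F. r A = j}"
      have "1 \<le> exp (\<gamma> * (real_of_int (diam A) - real j))"
        using Min[of A] A \<gamma>_pos by simp
      also have "\<dots> = exp (- \<gamma>) ^ j * exp (\<gamma> * real_of_int (diam A))"
        by (simp add: exp_of_nat_mult[symmetric] exp_add[symmetric] algebra_simps)
      finally show "b A \<le> exp (- \<gamma>) ^ j * (exp (\<gamma> * real_of_int (diam A)) * b A)"
        using mult_right_mono[of 1 "exp (- \<gamma>) ^ j * exp (\<gamma> * real_of_int (diam A))" "b A"]
          b_nonneg[of A] A F by (auto simp: crossing_def mult.assoc)
    qed
    also have "\<dots> = exp (- \<gamma>) ^ j * (\<Sum>A\<in>{A \<in> F. r A = j}. exp (\<gamma> * real_of_int (diam A)) * b A)"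
      by (simp add: sum_distrib_left)
    \<comment> \<open>All sets in group \<open>j\<close> contain the same site
      \<open>c - int j\<close>, their minimum, so the bound at a single site applies.\<close>
    also have "\<dots> \<le> exp (- \<gamma>) ^ j * S"
    proof (intro mult_left_mono sum_at_site_le[where i = "c - int j"])
      show "{A \<in> F. r A = j} \<subseteq> {A \<in> finsets. c - int j \<in> A}"
      proof safe
        fix A assume A: "A \<in> F" "j = r A"
        then show "A \<in> finsets" using F by (auto simp: crossing_def)
        show "c - int (r A) \<in> A" using Min[OF A(1)] by (simp add: r_def)
      qed
    qed (use F in auto)
    finally show "(\<Sum>A\<in>{A \<in> F. r A = j}. b A) \<le> S * exp (- \<gamma>) ^ j" by (simp add: mult.commute)
  qed
  also have "\<dots> = S * (\<Sum>j\<in>r ` F. exp (- \<gamma>) ^ j)" by (simp add: sum_distrib_left)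
  also have "\<dots> \<le> S * (\<Sum>j. exp (- \<gamma>) ^ j)"
    using F \<gamma>_pos S_nonneg by (intro mult_left_mono sum_le_suminf summable_geometric) auto
  also have "\<dots> = D" using \<gamma>_pos by (subst suminf_geometric) (auto simp: D_def)
  finally show ?thesis .
qed

section \<open>Free Hamiltonian and partition function\<close>

definition H :: "int set \<Rightarrow> 'a config \<Rightarrow> real" where
  "H L s = (\<Sum>A\<in>{A \<in> finsets. A \<subseteq> L}. U A s)"

text \<open>Keeping \<open>q\<close> outside \<open>H\<close> lets the one constant \<open>D\<close>
  of \<open>U\<close> serve for both \<open>q = 1\<close> and \<open>q = 2\<close>.\<close>

definition Z :: "real \<Rightarrow> int set \<Rightarrow> real" where
  "Z q L = (\<Sum>s\<in>config_on L. exp (- (q * H L s)))"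

lemma finite_subsets: "finite L \<Longrightarrow> finite {A \<in> finsets. A \<subseteq> L}"
  by (rule finite_subset[of _ "Pow L"]) auto

lemma Z_pos: "finite L \<Longrightarrow> Z q L > 0"
  unfolding Z_def by (intro sum_pos finite_config_on config_on_nonempty) auto

lemma H_local: "(\<And>a. a \<in> L \<Longrightarrow> s a = t a) \<Longrightarrow> H L s = H L t"
  unfolding H_def by (intro sum.cong refl U_local) auto

lemma H_translate: "H ((\<lambda>a. a + i) ` L) (shift (-i) s) = H L s"
  unfolding H_def
proof (rule sum.reindex_bij_witness[where i = "(`) (\<lambda>a. a + i)" and j = "(`) (\<lambda>a. a - i)"])
  fix A assume "A \<in> {A \<in> finsets. A \<subseteq> (\<lambda>a. a + i) ` L}"
  then show "(\<lambda>a. a - i) ` A \<in> {A \<in> finsets. A \<subseteq> L}"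
    using translate_in_finsets[of "-i" A] by auto
  have eq: "(\<lambda>a. a + i) ` ((\<lambda>a. a - i) ` A) = A" by (auto simp: image_image)
  then show "(\<lambda>a. a + i) ` ((\<lambda>a. a - i) ` A) = A" .
  show "U ((\<lambda>a. a - i) ` A) s = U A (shift (-i) s)"
    using U_translate[of "(\<lambda>a. a - i) ` A" i s] eq \<open>(\<lambda>a. a - i) ` A \<in> _\<close> by simp
next
  fix A assume "A \<in> {A \<in> finsets. A \<subseteq> L}"
  then show "(\<lambda>a. a + i) ` A \<in> {A \<in> finsets. A \<subseteq> (\<lambda>a. a + i) ` L}" by auto
  show "(\<lambda>a. a - i) ` ((\<lambda>a. a + i) ` A) = A" by (auto simp: image_image)
qed

lemma Z_translate: "Z q ((\<lambda>a. a + i) ` L) = Z q L"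
  unfolding Z_def
  by (subst sum.reindex_bij_betw[OF bij_betw_shift_config_on[of i L], symmetric])
     (simp add: H_translate)

text \<open>The terms of the union that belong to neither piece come from sets meeting both pieces,
  and these cross the cut at \<open>c\<close>.\<close>

lemma H_split:
  assumes "L1 \<subseteq> {..c}" "L2 \<subseteq> {c<..}" "finite L1" "finite L2"
  shows "\<bar>H (L1 \<union> L2) s - H L1 s - H L2 s\<bar> \<le> D"
proof -
  have disj: "L1 \<inter> L2 = {}" using assms by force
  let ?F = "{A \<in> finsets. A \<subseteq> L1 \<union> L2} - ({A \<in> finsets. A \<subseteq> L1} \<union> {A \<in> finsets. A \<subseteq> L2})"
  have fin: "finite {A \<in> finsets. A \<subseteq> L1 \<union> L2}" "finite {A \<in> finsets. A \<subseteq> L1}"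
    "finite {A \<in> finsets. A \<subseteq> L2}" using assms finite_subsets by auto
  \<comment> \<open>A common member would be empty, and \<open>finsets\<close> excludes the empty
    set.\<close>
  have "{A \<in> finsets. A \<subseteq> L1} \<inter> {A \<in> finsets. A \<subseteq> L2} = {}"
    using disj by (auto simp: finsets_def)
  then have "H (L1 \<union> L2) s = (\<Sum>A\<in>?F. U A s) + (H L1 s + H L2 s)"
    unfolding H_def using fin
    by (subst sum.union_disjoint[symmetric], simp, simp, simp, subst sum.subset_diff) auto
  moreover have "\<bar>\<Sum>A\<in>?F. U A s\<bar> \<le> sum b ?F"
    by (rule order_trans[OF sum_abs]) (auto intro!: sum_mono U_bound)
  moreover have "sum b ?F \<le> D"
  proof (rule sum_b_crossing_le)
    show "finite ?F" using fin by auto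
    show "?F \<subseteq> crossing c"
    proof
      fix A assume A: "A \<in> ?F"
      then obtain x y where "x \<in> A" "x \<in> L1" "y \<in> A" "y \<in> L2" by blast
      with assms A show "A \<in> crossing c" by (auto simp: crossing_def)
    qed
  qed
  ultimately show ?thesis by linarith
qed

text \<open>The error in \<open>H_split\<close> is uniform over configurations, so the sum over
  glued configurations factorizes up to \<open>exp (q * D)\<close> in either direction.\<close>

lemma ln_Z_union:
  assumes "L1 \<subseteq> {..c}" "L2 \<subseteq> {c<..}" "finite L1" "finite L2" "q \<ge> 0"
  shows "\<bar>ln (Z q (L1 \<union> L2)) - ln (Z q L1) - ln (Z q L2)\<bar> \<le> q * D"
proof -
  have disj: "L1 \<inter> L2 = {}" using assms by force
  have prod: "Z q L1 * Z q L2 =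
      (\<Sum>s\<in>config_on L1. \<Sum>t\<in>config_on L2. exp (- (q * H L1 s + q * H L2 t)))"
    by (simp add: Z_def sum_product exp_add[symmetric])
  have Zun: "Z q (L1 \<union> L2) =
      (\<Sum>s\<in>config_on L1. \<Sum>t\<in>config_on L2. exp (- (q * H (L1 \<union> L2) (glue L1 s t))))"
    unfolding Z_def by (rule sum_config_on_union[OF disj])
  have close: "\<bar>q * H (L1 \<union> L2) (glue L1 s t) - (q * H L1 s + q * H L2 t)\<bar> \<le> q * D" for s t
  proof -
    have "H L1 (glue L1 s t) = H L1 s" by (rule H_local) (simp add: glue_def)
    moreover have "H L2 (glue L1 s t) = H L2 t"
      by (rule H_local) (use disj in \<open>auto simp: glue_def\<close>)
    ultimately have "\<bar>H (L1 \<union> L2) (glue L1 s t) - (H L1 s + H L2 t)\<bar> \<le> D"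
      using H_split[of L1 c L2 "glue L1 s t"] assms by (simp add: algebra_simps)
    then have "q * \<bar>H (L1 \<union> L2) (glue L1 s t) - (H L1 s + H L2 t)\<bar> \<le> q * D"
      using assms by (intro mult_left_mono) auto
    also have "q * \<bar>H (L1 \<union> L2) (glue L1 s t) - (H L1 s + H L2 t)\<bar>
        = \<bar>q * H (L1 \<union> L2) (glue L1 s t) - (q * H L1 s + q * H L2 t)\<bar>"
      using assms by (simp add: abs_mult_pos' algebra_simps)
    finally show ?thesis .
  qed
  have pos: "Z q (L1 \<union> L2) > 0" "Z q L1 > 0" "Z q L2 > 0"
    using assms by (auto intro: Z_pos)
  have "exp (- (q * D)) * (Z q L1 * Z q L2) \<le> Z q (L1 \<union> L2)"
    unfolding prod Zun sum_distrib_left by (intro sum_mono exp_between(1) close)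
  then have "ln (exp (- (q * D)) * (Z q L1 * Z q L2)) \<le> ln (Z q (L1 \<union> L2))"
    using pos by (subst ln_le_cancel_iff) auto
  moreover have "Z q (L1 \<union> L2) \<le> exp (q * D) * (Z q L1 * Z q L2)"
    unfolding prod Zun sum_distrib_left by (intro sum_mono exp_between(2) close)
  then have "ln (Z q (L1 \<union> L2)) \<le> ln (exp (q * D) * (Z q L1 * Z q L2))"
    using pos by (subst ln_le_cancel_iff) auto
  ultimately show ?thesis using pos by (simp add: ln_mult_pos abs_le_iff)
qed

text \<open>Cutting a segment after \<open>m\<close> sites and translating the second block back
  makes \<open>ln (Z q (segment n))\<close> quasi-additive with error \<open>q * D\<close>.\<close>

lemma pressure_scale_rate:
  assumes "q \<ge> 0"
  shows "\<bar>ln (Z q (segment (int n))) - real n * pressure (scale q U)\<bar> \<le> 2 * (q * D)"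
proof -
  let ?a = "\<lambda>n. ln (Z q (segment (int n)))"
  have "\<bar>?a (m + n) - ?a m - ?a n\<bar> \<le> q * D" for m n
  proof -
    have un: "segment (int (m + n)) = segment (int m) \<union> (\<lambda>a. a + int m) ` segment (int n)"
      by (auto simp: set_eq_iff mem_translate_iff segment_def)
    have "\<bar>?a (m + n) - ?a m - ln (Z q ((\<lambda>a. a + int m) ` segment (int n)))\<bar> \<le> q * D"
      unfolding un by (rule ln_Z_union[of _ "int m"]) (use assms in \<open>auto simp: segment_def\<close>)
    then show ?thesis by (simp only: Z_translate)
  qed
  then obtain p where p: "(\<lambda>n. 1 / real n * ?a n) \<longlonglongrightarrow> p" "\<And>n. \<bar>?a n - real n * p\<bar> \<le> 2 * (q * D)"
    using quasi_additive_rate[of ?a "q * D"] by blast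
  \<comment> \<open>Convergence is already proved, so \<open>lim\<close> in \<open>pressure\<close>
    denotes the true limit \<open>p\<close>.\<close>
  have "pressure (scale q U) = lim (\<lambda>n. 1 / real n * ?a n)"
    by (simp add: pressure_def scale_def Z_def H_def sum_distrib_left)
  with p show ?thesis by (simp add: limI)
qed

text \<open>The probability that two independent words on \<open>L\<close> with law
  \<open>exp (- H L x) / Z 1 L\<close> coincide.\<close>

definition collision :: "int set \<Rightarrow> real" where
  "collision L = Z 2 L / (Z 1 L)\<^sup>2"

lemma collision_exponential:
  shows "exp (- (8 * D)) * exp (- (2 * decay_rate U * real n)) \<le> collision (segment (int n))"
    and "collision (segment (int n)) \<le> exp (8 * D) * exp (- (2 * decay_rate U * real n))"
proof -
  have pos: "Z q (segment (int n)) > 0" for q by (rule Z_pos) (simp add: segment_def)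
  have s1: "scale 1 U = U" by (simp add: scale_def)
  have "ln (collision (segment (int n))) = ln (Z 2 (segment (int n))) - 2 * ln (Z 1 (segment (int n)))"
    using pos[of 1] pos[of 2] by (simp add: collision_def ln_div ln_realpow)
  \<comment> \<open>The numerator contributes \<open>2 * (2 * D)\<close> and the squared denominator
    twice \<open>2 * D\<close>, which gives \<open>8 * D\<close>.\<close>
  then have "\<bar>ln (collision (segment (int n))) + 2 * decay_rate U * real n\<bar> \<le> 8 * D"
    using pressure_scale_rate[of 1 n] pressure_scale_rate[of 2 n]
    by (simp add: s1 decay_rate_def abs_le_iff algebra_simps)
  then have "- (8 * D) - 2 * decay_rate U * real n \<le> ln (collision (segment (int n)))"
    "ln (collision (segment (int n))) \<le> 8 * D - 2 * decay_rate U * real n" by linarith+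
  moreover have "exp (ln (collision (segment (int n)))) = collision (segment (int n))"
    using pos[of 1] pos[of 2] by (simp add: collision_def)
  ultimately show "exp (- (8 * D)) * exp (- (2 * decay_rate U * real n)) \<le> collision (segment (int n))"
    "collision (segment (int n)) \<le> exp (8 * D) * exp (- (2 * decay_rate U * real n))"
    unfolding exp_add[symmetric] by (metis diff_conv_add_uminus exp_le_cancel_iff)+
qed

section \<open>Positivity of the decay rate\<close>

text \<open>Only sets containing a site of disagreement contribute, each at most
  \<open>2 * b A\<close>. Charging a set to every such site it contains overcounts, but keeps the
  cost per site at most \<open>2 * S\<close>.\<close>

lemma H_diff_le:
  assumes "finite L"
  shows "\<bar>H L s - H L t\<bar> \<le> 2 * S * real (card {i \<in> L. s i \<noteq> t i})"
proof -
  let ?W = "{i \<in> L. s i \<noteq> t i}" and ?F = "{A \<in> finsets. A \<subseteq> L}"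
  have W: "finite ?W" and F: "finite ?F" using assms finite_subsets by auto
  have "\<bar>H L s - H L t\<bar> = \<bar>\<Sum>A\<in>?F. U A s - U A t\<bar>" by (simp add: H_def sum_subtractf)
  also have "\<dots> \<le> (\<Sum>A\<in>?F. \<Sum>i\<in>?W. if i \<in> A then 2 * b A else 0)"
  proof (rule order_trans[OF sum_abs], rule sum_mono)
    fix A assume A: "A \<in> ?F"
    then have fs: "A \<in> finsets" by simp
    have nn: "\<And>i. (if i \<in> A then 2 * b A else 0) \<ge> 0" using b_nonneg[OF fs] by simp
    show "\<bar>U A s - U A t\<bar> \<le> (\<Sum>i\<in>?W. if i \<in> A then 2 * b A else 0)"
    proof (cases "\<exists>i\<in>?W. i \<in> A")
      case True
      then obtain i where i: "i \<in> ?W" "i \<in> A" by blast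
      have "\<bar>U A s - U A t\<bar> \<le> 2 * b A" using U_bound[OF fs, of s] U_bound[OF fs, of t] by linarith
      also have "\<dots> = (if i \<in> A then 2 * b A else 0)" using i by simp
      also have "\<dots> \<le> (\<Sum>i\<in>?W. if i \<in> A then 2 * b A else 0)"
        by (rule member_le_sum[OF i(1) nn W])
      finally show ?thesis .
    next
      case False
      then have "U A s = U A t" using A by (intro U_local) auto
      then show ?thesis using nn by (simp add: sum_nonneg)
    qed
  qed
  also have "\<dots> = (\<Sum>i\<in>?W. \<Sum>A\<in>?F. if i \<in> A then 2 * b A else 0)" by (rule sum.swap)
  also have "\<dots> = (\<Sum>i\<in>?W. 2 * sum b {A \<in> ?F. i \<in> A})"
    using F by (simp add: sum.inter_filter[symmetric] sum_distrib_left)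
  also have "\<dots> \<le> (\<Sum>i\<in>?W. 2 * S)"
    using F by (intro sum_mono mult_left_mono sum_b_at_site_le finite_subset[OF _ F]) auto
  finally show ?thesis by (simp add: mult_ac)
qed

text \<open>A one-site partition function: the reference letter has weight 1 and every other letter
  the worst-case weight \<open>exp (- (2 * S))\<close> of a single flip.\<close>

definition site_factor :: real where
  "site_factor = 1 + (real CARD('a) - 1) * exp (- (2 * S))"

text \<open>Flipping the configuration at a set \<open>W\<close> of sites costs at most \<open>2 * S * card W\<close> in energy,
  so no single configuration carries more than an exponentially small share of the total weight.\<close>

lemma weight_le_Z:
  assumes L: "finite L"
  shows "exp (- H L x) * site_factor ^ card L \<le> Z 1 L"
proof -
  define w :: "int \<Rightarrow> 'a \<Rightarrow> real" where "w i a = (if a = x i then 1 else exp (- (2 * S)))" for i a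
  have "site_factor ^ card L = (\<Prod>i\<in>L. \<Sum>a\<in>UNIV. w i a)"
  proof -
    have "(\<Sum>a\<in>UNIV. w i a) = site_factor" for i
    proof -
      have "(\<Sum>a\<in>UNIV. w i a) = w i (x i) + (\<Sum>a\<in>UNIV - {x i}. w i a)"
        by (rule sum.remove) auto
      also have "(\<Sum>a\<in>UNIV - {x i}. w i a) = (\<Sum>a\<in>UNIV - {x i}. exp (- (2 * S)))"
        by (intro sum.cong) (auto simp: w_def)
      also have "\<dots> = (real CARD('a) - 1) * exp (- (2 * S))"
        by (simp add: card_Diff_singleton of_nat_diff Suc_leI)
      finally show ?thesis by (simp add: w_def site_factor_def)
    qed
    then show ?thesis by simp
  qed
  \<comment> \<open>Expanding the product of one-site sums gives one term per word \<open>y\<close>,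
    to be compared with the corresponding term of \<open>Z 1 L\<close>.\<close>
  also have "\<dots> = (\<Sum>y\<in>config_on L. \<Prod>i\<in>L. w i (y i))"
    unfolding config_on_def by (rule prod_sum_PiE) (use L in auto)
  finally have "exp (- H L x) * site_factor ^ card L =
      (\<Sum>y\<in>config_on L. exp (- H L x) * (\<Prod>i\<in>L. w i (y i)))"
    by (simp add: sum_distrib_left)
  also have "\<dots> \<le> (\<Sum>y\<in>config_on L. exp (- (1 * H L y)))"
  proof (rule sum_mono)
    fix y :: "'a config"
    have "(\<Prod>i\<in>L. w i (y i)) = exp (- (2 * S)) ^ card {i \<in> L. y i \<noteq> x i}"
      using L by (simp add: w_def prod.If_cases Int_def)
    also have "\<dots> = exp (- (2 * S * real (card {i \<in> L. y i \<noteq> x i})))"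
      by (simp add: exp_of_nat_mult[symmetric] mult_ac)
    finally show "exp (- H L x) * (\<Prod>i\<in>L. w i (y i)) \<le> exp (- (1 * H L y))"
      using exp_between(1)[OF H_diff_le[OF L, of y x]] by (simp add: mult_ac)
  qed
  finally show ?thesis by (simp add: Z_def)
qed

text \<open>A sum of squared probabilities is at most the largest probability, which
  \<open>weight_le_Z\<close> bounds.\<close>

lemma collision_le:
  assumes L: "finite L"
  shows "collision L \<le> (1 / site_factor) ^ card L"
proof -
  have sf: "site_factor > 0"
    unfolding site_factor_def by (intro add_pos_nonneg mult_nonneg_nonneg) (auto simp: Suc_leI)
  have "Z 2 L = (\<Sum>x\<in>config_on L. exp (- H L x) * exp (- H L x))"
    by (simp add: Z_def exp_add[symmetric])
  also have "\<dots> \<le> (\<Sum>x\<in>config_on L. exp (- H L x) * (Z 1 L / site_factor ^ card L))"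
    using weight_le_Z[OF L] sf by (intro sum_mono mult_left_mono) (auto simp: field_simps)
  also have "\<dots> = Z 1 L * (Z 1 L / site_factor ^ card L)"
    by (simp add: Z_def sum_distrib_right sum_divide_distrib)
  finally have "Z 2 L \<le> (1 / site_factor) ^ card L * (Z 1 L)\<^sup>2"
    by (simp add: power_divide power2_eq_square)
  then show ?thesis using Z_pos[OF L, of 1] by (simp add: collision_def pos_divide_le_eq)
qed

text \<open>If the rate were not positive, collisions on \<open>segment n\<close> would stay above
  \<open>exp (- (8 * D))\<close> for all \<open>n\<close>. With two letters
  \<open>site_factor\<close> exceeds 1, so \<open>collision_le\<close> forces them to vanish
  exponentially.\<close>

lemma decay_rate_pos:
  assumes "CARD('a) \<ge> 2"
  shows "decay_rate U > 0"
proof (rule ccontr)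
  assume neg: "\<not> decay_rate U > 0"
  have sf: "site_factor > 1"
    using assms by (simp add: site_factor_def)
  obtain n :: nat where n: "8 * D < real n * ln site_factor"
    using reals_Archimedean3[of "ln site_factor"] sf by auto
  have "exp (- (8 * D)) * 1 \<le> exp (- (8 * D)) * exp (- (2 * decay_rate U * real n))"
    using neg by (intro mult_left_mono) (auto simp: mult_nonpos_nonneg)
  also have "\<dots> \<le> collision (segment (int n))" by (rule collision_exponential)
  also have "\<dots> \<le> (1 / site_factor) ^ n"
    using collision_le[of "segment (int n)"] by (simp add: segment_def)
  also have "\<dots> = exp (- (real n * ln site_factor))"
    using sf by (simp add: exp_minus exp_of_nat_mult power_one_over inverse_eq_divide)
  finally show False using n by simp
qed

section \<open>Marginals of the Gibbs measure\<close>

text \<open>The interval has two boundary cuts, each of total interaction at most \<open>D\<close>.\<close>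

lemma hamiltonian_interval:
  assumes "l < r"
  shows "\<bar>hamiltonian U {l<..r} z s - H {l<..r} s\<bar> \<le> 2 * D"
proof -
  let ?L = "{l<..r}" let ?g = "glue ?L s z"
  \<comment> \<open>The sets that couple the interval to its outside. Each reaches past the left end
    or the right end, hence crosses one of the two cuts.\<close>
  define X where "X = {A \<in> finsets. A \<inter> ?L \<noteq> {} \<and> \<not> A \<subseteq> ?L}"
  have X_sub: "X \<subseteq> crossing l \<union> crossing r"
  proof
    fix A assume "A \<in> X"
    then obtain x y where "A \<in> finsets" "x \<in> A" "x \<in> ?L" "y \<in> A" "y \<notin> ?L" unfolding X_def by blast
    then show "A \<in> crossing l \<union> crossing r" by (cases "y \<le> l") (auto simp: crossing_def not_le)
  qed
  have fin_le: "(\<Sum>A\<in>F. norm (U A ?g)) \<le> 2 * D" if F: "finite F" "F \<subseteq> X" for F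
  proof -
    have "(\<Sum>A\<in>F. norm (U A ?g)) \<le> sum b F"
      using F by (intro sum_mono) (auto simp: X_def U_bound)
    \<comment> \<open>Sets crossing both cuts are assigned to the left one only.\<close>
    also have "sum b F = sum b ((F \<inter> crossing l) \<union> (F - crossing l))"
      by (rule arg_cong[where f = "sum b"]) auto
    also have "\<dots> = sum b (F \<inter> crossing l) + sum b (F - crossing l)"
      using F by (intro sum.union_disjoint) auto
    also have "\<dots> \<le> D + D"
      using F X_sub by (intro add_mono sum_b_crossing_le[where c = l] sum_b_crossing_le[where c = r]) auto
    finally show ?thesis by simp
  qed
  \<comment> \<open>Since \<open>infsum\<close> is 0 for a non-summable family, summability has to
    be secured before the Hamiltonian is split.\<close>
  have abs: "(\<lambda>A. norm (U A ?g)) summable_on X"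
    using fin_le by (intro nonneg_bdd_above_summable_on bdd_aboveI2[where M = "2 * D"]) auto
  have "norm (infsum (\<lambda>A. U A ?g) X) \<le> infsum (\<lambda>A. norm (U A ?g)) X"
    using abs by (rule norm_infsum_bound)
  also have "\<dots> \<le> 2 * D" using abs fin_le by (rule infsum_le_finite_sums)
  finally have le: "\<bar>infsum (\<lambda>A. U A ?g) X\<bar> \<le> 2 * D" by simp
  have "{A \<in> finsets. A \<inter> ?L \<noteq> {}} = {A \<in> finsets. A \<subseteq> ?L} \<union> X"
    by (auto simp: X_def finsets_def)
  then have "hamiltonian U ?L z s = infsum (\<lambda>A. U A ?g) ({A \<in> finsets. A \<subseteq> ?L} \<union> X)"
    by (simp add: hamiltonian_def)
  also have "\<dots> = infsum (\<lambda>A. U A ?g) {A \<in> finsets. A \<subseteq> ?L} + infsum (\<lambda>A. U A ?g) X"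
  proof (rule infsum_Un_disjoint)
    show "(\<lambda>A. U A ?g) summable_on {A \<in> finsets. A \<subseteq> ?L}"
      by (rule summable_on_finite) (simp add: finite_subsets)
    show "(\<lambda>A. U A ?g) summable_on X" using abs by (rule abs_summable_summable)
    show "{A \<in> finsets. A \<subseteq> ?L} \<inter> X = {}" by (auto simp: X_def)
  qed
  also have "infsum (\<lambda>A. U A ?g) {A \<in> finsets. A \<subseteq> ?L} = H ?L ?g"
    using finite_subsets[of ?L] by (simp add: H_def)
  also have "H ?L ?g = H ?L s" by (rule H_local) (simp add: glue_def)
  finally show ?thesis using le by simp
qed

text \<open>Replacing the Hamiltonian by the free one changes numerator and denominator by at most
  \<open>exp (2 * D)\<close> each, whatever the boundary condition \<open>z\<close>.\<close>

lemma gibbs_weight_interval: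
  assumes "l < r" "L = {l<..r}"
  shows "exp (- (4 * D)) * (exp (- H L x) / Z 1 L) \<le> gibbs_weight U L z x"
    and "gibbs_weight U L z x \<le> exp (4 * D) * (exp (- H L x) / Z 1 L)"
proof -
  let ?G = "\<Sum>s\<in>config_on L. exp (- hamiltonian U L z s)"
  have Zpos: "Z 1 L > 0" using assms by (intro Z_pos) auto
  note close = exp_between[OF hamiltonian_interval[OF assms(1), folded assms(2)]]
  have G1: "exp (- (2 * D)) * Z 1 L \<le> ?G"
    unfolding Z_def sum_distrib_left by (intro sum_mono) (simp add: close)
  have G2: "?G \<le> exp (2 * D) * Z 1 L"
    unfolding Z_def sum_distrib_left by (intro sum_mono) (simp add: close)
  have "0 < exp (- (2 * D)) * Z 1 L" using Zpos by simp
  with G1 have Gpos: "?G > 0" by linarith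
  have split: "exp (4 * D) = exp (2 * D) * exp (2 * D)" by (simp add: exp_add[symmetric])
  have "exp (- (4 * D)) * (exp (- H L x) / Z 1 L) = (exp (- (2 * D)) * exp (- H L x)) / (exp (2 * D) * Z 1 L)"
    unfolding split exp_minus using Zpos by (simp add: field_simps)
  also have "\<dots> \<le> exp (- hamiltonian U L z x) / ?G"
    using close(1) G2 Gpos by (intro frac_le) auto
  finally show "exp (- (4 * D)) * (exp (- H L x) / Z 1 L) \<le> gibbs_weight U L z x"
    by (simp add: gibbs_weight_def)
  have "exp (- hamiltonian U L z x) / ?G \<le> (exp (2 * D) * exp (- H L x)) / (exp (- (2 * D)) * Z 1 L)"
    using close(2) G1 Zpos by (intro frac_le) auto
  also have "\<dots> = exp (4 * D) * (exp (- H L x) / Z 1 L)"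
    unfolding split exp_minus using Zpos by (simp add: field_simps)
  finally show "gibbs_weight U L z x \<le> exp (4 * D) * (exp (- H L x) / Z 1 L)"
    by (simp add: gibbs_weight_def)
qed

text \<open>The bounds on the conditional probability do not depend on \<open>z\<close>, so they
  survive integration over \<open>z\<close>, which yields the unconditional probability.\<close>

lemma gibbs_marginal_interval:
  assumes gibbs: "gibbs_measure U P" and lr: "l < r" and L: "L = {l<..r}"
    and x: "x \<in> config_on L"
  shows "exp (- (4 * D)) * (exp (- H L x) / Z 1 L) \<le> measure P {s. restrict s L = x}"
    and "measure P {s. restrict s L = x} \<le> exp (4 * D) * (exp (- H L x) / Z 1 L)"
proof -
  let ?E = "{s. restrict s L = x}" and ?F = "config_algebra (- L) :: 'a config measure"
  let ?c = "real_cond_exp P ?F (indicat_real ?E)"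
  interpret prob_space P using gibbs by (simp add: gibbs_measure_def)
  have sets: "sets P = sets config_space" using gibbs by (simp add: gibbs_measure_def)
  interpret cond: finite_measure_subalgebra P ?F
    by unfold_locales (rule subalgebra_config_algebra[OF sets])
  have E: "?E \<in> sets P" using cylinder_sets[of L 0 x] L by (simp add: sets)
  then have int: "integrable P (indicat_real ?E)" by (simp add: integrable_indicator_iff emeasure_eq_measure)
  have "L \<in> finsets" using lr L by (simp add: finsets_def)
  then have "AE z in P. ?c z = gibbs_weight U L z x"
    using gibbs x by (force simp: gibbs_measure_def elim: eventually_mono)
  then have lower: "AE z in P. exp (- (4 * D)) * (exp (- H L x) / Z 1 L) \<le> ?c z"
    and upper: "AE z in P. ?c z \<le> exp (4 * D) * (exp (- H L x) / Z 1 L)"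
    using gibbs_weight_interval[OF lr L, where x = x] by (auto elim!: eventually_mono)
  have "measure P ?E = (\<integral>z. ?c z \<partial>P)"
    using cond.real_cond_exp_int(2)[OF int] E by simp
  then show "exp (- (4 * D)) * (exp (- H L x) / Z 1 L) \<le> measure P ?E"
    and "measure P ?E \<le> exp (4 * D) * (exp (- H L x) / Z 1 L)"
    using integral_ge_const[OF cond.real_cond_exp_int(1)[OF int] lower]
      integral_le_const[OF cond.real_cond_exp_int(1)[OF int] upper] by simp_all
qed

text \<open>Translation invariance of \<open>H\<close> and \<open>Z\<close> makes the bounds
  independent of \<open>i\<close>; it does here the work of stationarity of
  \<open>P\<close>.\<close>

lemma gibbs_marginal_shift:
  assumes gibbs: "gibbs_measure U P" and k: "k \<ge> 1" and x: "x \<in> config_on (segment k)"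
  shows "exp (- (4 * D)) * (exp (- H (segment k) x) / Z 1 (segment k))
      \<le> measure P {s. restrict (shift i s) (segment k) = x}"
    and "measure P {s. restrict (shift i s) (segment k) = x}
      \<le> exp (4 * D) * (exp (- H (segment k) x) / Z 1 (segment k))"
proof -
  \<comment> \<open>As \<open>segment k\<close> starts at 1, window \<open>i\<close> covers the
    sites \<open>i + 1\<close> to \<open>i + k\<close>.\<close>
  have L: "(\<lambda>a. a + i) ` segment k = {i<..i + k}"
    by (auto simp: set_eq_iff mem_translate_iff segment_def)
  have "restrict (shift i s) (segment k) = x \<longleftrightarrow> restrict s {i<..i + k} = shift (-i) x" for s
  proof -
    have "shift (-i) (restrict (shift i s) (segment k)) = restrict s {i<..i + k}"
      by (auto simp: shift_def restrict_def segment_def fun_eq_iff)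
    then show ?thesis by (metis add.right_inverse shift_0 shift_shift)
  qed
  then have ev: "{s. restrict (shift i s) (segment k) = x} = {s. restrict s {i<..i + k} = shift (-i) x}"
    by simp
  have x': "shift (-i) x \<in> config_on {i<..i + k}"
    using bij_betw_shift_config_on[of i "segment k"] x by (auto simp: bij_betw_def L)
  have HZ: "H {i<..i + k} (shift (-i) x) = H (segment k) x" "Z 1 {i<..i + k} = Z 1 (segment k)"
    using H_translate[of i "segment k" x] Z_translate[of 1 i "segment k"] by (simp_all add: L)
  show "exp (- (4 * D)) * (exp (- H (segment k) x) / Z 1 (segment k))
      \<le> measure P {s. restrict (shift i s) (segment k) = x}"
    "measure P {s. restrict (shift i s) (segment k) = x}
      \<le> exp (4 * D) * (exp (- H (segment k) x) / Z 1 (segment k))"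
    using gibbs_marginal_interval[OF gibbs _ refl x'] k by (simp_all add: ev HZ)
qed

end

section \<open>Expected number of matches\<close>

definition match_prob :: "'a config measure \<Rightarrow> int \<Rightarrow> int \<Rightarrow> int \<Rightarrow> real" where
  "match_prob P k i j = (\<Sum>x\<in>config_on (segment k).
     measure P {s. restrict (shift i s) (segment k) = x} *
     measure P {s. restrict (shift j s) (segment k) = x})"

text \<open>The match event is a disjoint union, over the common word \<open>x\<close>, of product
  events. Stating this with \<open>has_bochner_integral\<close> carries integrability through the
  later sums.\<close>

lemma has_integral_match:
  fixes P :: "'a::finite config measure"
  assumes "prob_space P" "sets P = sets config_space"
  shows "has_bochner_integral (P \<Otimes>\<^sub>M P)
    (\<lambda>(s, t). of_bool (restrict (shift i s) (segment k) = restrict (shift j t) (segment k)))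
    (match_prob P k i j)"
proof -
  interpret prob_space P by fact
  interpret PP: pair_prob_space P P ..
  let ?A = "\<lambda>i x. {s :: 'a config. restrict (shift i s) (segment k) = x}"
  have fin: "finite (segment k)" by (simp add: segment_def)
  have A: "?A i x \<in> sets P" for i x using cylinder_sets[OF fin] by (simp add: assms(2))
  have "(\<lambda>(s, t). of_bool (restrict (shift i s) (segment k) = restrict (shift j t) (segment k)))
      = (\<lambda>p. \<Sum>x\<in>config_on (segment k). indicat_real (?A i x \<times> ?A j x) p)"
  proof
    fix p :: "'a config \<times> 'a config"
    obtain s t where p: "p = (s, t)" by (cases p)
    have "(\<Sum>x\<in>config_on (segment k). indicat_real (?A i x \<times> ?A j x) (s, t))
        = (\<Sum>x\<in>config_on (segment k). if x = restrict (shift i s) (segment k)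
             then of_bool (restrict (shift i s) (segment k) = restrict (shift j t) (segment k)) else 0)"
      by (intro sum.cong) (auto simp: indicator_def)
    also have "\<dots> = of_bool (restrict (shift i s) (segment k) = restrict (shift j t) (segment k))"
      by (simp only: sum.delta finite_config_on[OF fin] restrict_in_config_on if_True)
    finally show "(case p of (s, t) \<Rightarrow>
        of_bool (restrict (shift i s) (segment k) = restrict (shift j t) (segment k)))
      = (\<Sum>x\<in>config_on (segment k). indicat_real (?A i x \<times> ?A j x) p)"
      by (simp add: p)
  qed
  moreover have "has_bochner_integral (P \<Otimes>\<^sub>M P)
      (\<lambda>p. \<Sum>x\<in>config_on (segment k). indicat_real (?A i x \<times> ?A j x) p)
      (\<Sum>x\<in>config_on (segment k). measure P (?A i x) * measure P (?A j x))"
  proof (rule has_bochner_integral_sum)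
    fix x
    have "measure (P \<Otimes>\<^sub>M P) (?A i x \<times> ?A j x) = measure P (?A i x) * measure P (?A j x)"
      by (simp add: measure_def emeasure_pair_measure_Times[OF A A] enn2real_mult)
    then show "has_bochner_integral (P \<Otimes>\<^sub>M P) (indicat_real (?A i x \<times> ?A j x))
        (measure P (?A i x) * measure P (?A j x))"
      using has_bochner_integral_real_indicator[of "?A i x \<times> ?A j x" "P \<Otimes>\<^sub>M P"] A
      by (simp add: PP.emeasure_eq_measure)
  qed
  ultimately show ?thesis by (simp add: match_prob_def)
qed

lemma expected_matches_eq:
  fixes P :: "'a::finite config measure"
  assumes "prob_space P" "sets P = sets config_space"
  shows "expected_matches P n k = (\<Sum>i\<in>{0..int n - k}. \<Sum>j\<in>{0..int n - k} - {i}. match_prob P k i j)"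
proof -
  have "has_bochner_integral (P \<Otimes>\<^sub>M P) (\<lambda>p. \<Sum>i\<in>{0..int n - k}. \<Sum>j\<in>{0..int n - k} - {i}.
      (\<lambda>(s, t). of_bool (restrict (shift i s) (segment k) = restrict (shift j t) (segment k))) p)
    (\<Sum>i\<in>{0..int n - k}. \<Sum>j\<in>{0..int n - k} - {i}. match_prob P k i j)"
    by (intro has_bochner_integral_sum has_integral_match assms)
  then show ?thesis
    unfolding expected_matches_def shift_matches_def
    by (simp add: has_bochner_integral_integral_eq case_prod_unfold)
qed

section \<open>Two-sided bounds on the expected number of matches\<close>

context decaying_interaction
begin

text \<open>The two marginals cost \<open>exp (4 * D)\<close> each and
  \<open>collision_exponential\<close> costs \<open>exp (8 * D)\<close>, hence
  \<open>16 * D\<close>. Nothing depends on \<open>i\<close> and \<open>j\<close>.\<close>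

lemma match_prob_bounds:
  assumes gibbs: "gibbs_measure U P" and k: "k \<ge> 1"
  shows "exp (- (16 * D)) * exp (- (2 * decay_rate U * of_int k)) \<le> match_prob P k i j"
    and "match_prob P k i j \<le> exp (16 * D) * exp (- (2 * decay_rate U * of_int k))"
proof -
  let ?L = "segment k" let ?p = "\<lambda>x. exp (- H ?L x) / Z 1 ?L"
  have Zpos: "Z 1 ?L > 0" by (rule Z_pos) (simp add: segment_def)
  have coll: "collision ?L = (\<Sum>x\<in>config_on ?L. ?p x * ?p x)"
    by (simp add: collision_def Z_def[of 2] sum_divide_distrib power2_eq_square exp_add[symmetric])
  have ck: "exp (- (8 * D)) * exp (- (2 * decay_rate U * of_int k)) \<le> collision ?L"
    "collision ?L \<le> exp (8 * D) * exp (- (2 * decay_rate U * of_int k))"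
    using collision_exponential[of "nat k"] k by simp_all
  have "exp (- (16 * D)) * exp (- (2 * decay_rate U * of_int k))
      = exp (- (8 * D)) * (exp (- (8 * D)) * exp (- (2 * decay_rate U * of_int k)))"
    by (simp add: exp_add[symmetric])
  also have "\<dots> \<le> exp (- (8 * D)) * collision ?L"
    using ck(1) by (intro mult_left_mono) auto
  also have "\<dots> = (\<Sum>x\<in>config_on ?L. (exp (- (4 * D)) * ?p x) * (exp (- (4 * D)) * ?p x))"
    unfolding coll sum_distrib_left by (intro sum.cong refl) (simp add: exp_add[symmetric])
  also have "\<dots> \<le> match_prob P k i j"
    unfolding match_prob_def using Zpos
    by (intro sum_mono mult_mono gibbs_marginal_shift(1)[OF gibbs k]) auto
  finally show "exp (- (16 * D)) * exp (- (2 * decay_rate U * of_int k)) \<le> match_prob P k i j" .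
  have "match_prob P k i j \<le> (\<Sum>x\<in>config_on ?L. (exp (4 * D) * ?p x) * (exp (4 * D) * ?p x))"
    unfolding match_prob_def using Zpos
    by (intro sum_mono mult_mono gibbs_marginal_shift(2)[OF gibbs k]) auto
  also have "\<dots> = exp (8 * D) * collision ?L"
    unfolding coll sum_distrib_left by (intro sum.cong refl) (simp add: exp_add[symmetric])
  also have "\<dots> \<le> exp (8 * D) * (exp (8 * D) * exp (- (2 * decay_rate U * of_int k)))"
    using ck(2) by (intro mult_left_mono) auto
  also have "\<dots> = exp (16 * D) * exp (- (2 * decay_rate U * of_int k))"
    by (simp add: exp_add[symmetric])
  finally show "match_prob P k i j \<le> exp (16 * D) * exp (- (2 * decay_rate U * of_int k))" .
qed

lemma expected_matches_bounds:
  assumes gibbs: "gibbs_measure U P" and k: "1 \<le> k" "k < int n"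
  defines "M \<equiv> of_int ((int n - k + 1) * (int n - k)) * exp (- (2 * decay_rate U * of_int k))"
  shows "exp (- (16 * D)) * M \<le> expected_matches P n k"
    and "expected_matches P n k \<le> exp (16 * D) * M"
proof -
  let ?I = "{0..int n - k}" and ?e = "exp (- (2 * decay_rate U * of_int k))"
  \<comment> \<open>There are \<open>n - k + 1\<close> window positions \<open>i\<close>, and each
    leaves \<open>n - k\<close> positions \<open>j\<close> different from it.\<close>
  have count: "(\<Sum>i\<in>?I. \<Sum>j\<in>?I - {i}. c * ?e) = c * M" for c :: real
  proof -
    have "real (card (?I - {i})) = of_int (int n - k)" if "i \<in> ?I" for i
      using that k by (simp add: card_Diff_singleton)
    then have "(\<Sum>i\<in>?I. \<Sum>j\<in>?I - {i}. c * ?e) = (\<Sum>i\<in>?I. of_int (int n - k) * (c * ?e))"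
      by (intro sum.cong) auto
    then show ?thesis using k by (simp add: M_def)
  qed
  have eq: "expected_matches P n k = (\<Sum>i\<in>?I. \<Sum>j\<in>?I - {i}. match_prob P k i j)"
    using gibbs by (intro expected_matches_eq) (auto simp: gibbs_measure_def)
  show "exp (- (16 * D)) * M \<le> expected_matches P n k"
    "expected_matches P n k \<le> exp (16 * D) * M"
    unfolding eq count[symmetric] by (intro sum_mono match_prob_bounds gibbs k)+
qed

end

section \<open>Asymptotics\<close>

text \<open>With \<open>x\<close> a word length, the right side is the order of the expected number
  of matches; the left side shows that only the distance of \<open>x\<close> from the critical
  length matters.\<close>

lemma square_exp_eq:
  assumes "n > 0" "\<alpha> > 0"
  shows "exp (2 * \<alpha> * (ln (real n) / \<alpha> - x)) = (real n)\<^sup>2 * exp (- (2 * \<alpha> * x))"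
proof -
  have "2 * \<alpha> * (ln (real n) / \<alpha> - x) = ln (real n) + ln (real n) + - (2 * \<alpha> * x)"
    using assms by (simp add: field_simps)
  then show ?thesis using assms by (simp only: exp_add) (simp add: power2_eq_square)
qed

lemma pair_count_le:
  assumes "1 \<le> k" "k < int n"
  shows "real_of_int ((int n - k + 1) * (int n - k)) \<le> (real n)\<^sup>2"
proof -
  \<comment> \<open>Here \<open>1 \<le> k\<close> absorbs the extra 1 in the first factor.\<close>
  have "(int n - k + 1) * (int n - k) \<le> int n * int n"
    using assms by (intro mult_mono) auto
  then show ?thesis unfolding power2_eq_square by (metis of_int_le_iff of_int_mult of_int_of_nat_eq)
qed

lemma pair_count_ge:
  assumes "of_int k \<le> real n / 2"
  shows "(real n)\<^sup>2 / 4 \<le> real_of_int ((int n - k + 1) * (int n - k))"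
proof -
  have "real n / 2 * (real n / 2) \<le> (real n - of_int k + 1) * (real n - of_int k)"
    using assms by (intro mult_mono) auto
  then show ?thesis by (simp add: power2_eq_square)
qed

theorem theorem5p2:
  fixes U :: "'a::finite interaction" and P :: "'a config measure" and k :: "nat \<Rightarrow> int"
  assumes "CARD('a) \<ge> 2"
    and "U \<in> interactions"
    and "gibbs_measure U P"
    and "\<forall>\<^sub>F n in sequentially. 1 \<le> k n \<and> k n < int n"
  shows "decay_rate U > 0 \<and>
    (filterlim (\<lambda>n. critical_length U n - of_int (k n)) at_top sequentially \<longrightarrow>
       filterlim (\<lambda>n. expected_matches P n (k n)) at_top sequentially) \<and>
    (filterlim (\<lambda>n. of_int (k n) - critical_length U n) at_top sequentially \<longrightarrow>
       (\<lambda>n. expected_matches P n (k n)) \<longlonglongrightarrow> 0) \<and>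
    (Bseq (\<lambda>n. of_int (k n) - critical_length U n) \<longrightarrow>
       0 < liminf (\<lambda>n. ereal (expected_matches P n (k n))) \<and>
       liminf (\<lambda>n. ereal (expected_matches P n (k n)))
         \<le> limsup (\<lambda>n. ereal (expected_matches P n (k n))) \<and>
       limsup (\<lambda>n. ereal (expected_matches P n (k n))) < \<infinity>)"
proof -
  obtain b \<gamma> S where "decaying_interaction U b \<gamma> S"
    using interactions_decaying[OF assms(2)] .
  then interpret decaying_interaction U b \<gamma> S .
  define \<alpha> where "\<alpha> = decay_rate U"
  have \<alpha>: "\<alpha> > 0" unfolding \<alpha>_def by (rule decay_rate_pos[OF assms(1)])
  let ?e = "\<lambda>n. expected_matches P n (k n)"
  \<comment> \<open>The predicted order of the expectation, equal to
    \<open>n^2 * exp (- 2 * \<alpha> * k n)\<close> for positive \<open>n\<close>.\<close>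
  define g where "g n = exp (2 * \<alpha> * (critical_length U n - of_int (k n)))" for n
  define c where "c = exp (16 * D)"
  have c: "c > 0" by (simp add: c_def)
  have g: "g n = (real n)\<^sup>2 * exp (- (2 * \<alpha> * of_int (k n)))" if "n > 0" for n
    using square_exp_eq[OF that \<alpha>] by (simp add: g_def critical_length_def \<alpha>_def)
  have upper: "\<forall>\<^sub>F n in sequentially. ?e n \<le> c * g n"
    using assms(4) eventually_gt_at_top[of 0]
  proof eventually_elim
    case (elim n)
    have "?e n \<le> c * (of_int ((int n - k n + 1) * (int n - k n)) * exp (- (2 * \<alpha> * of_int (k n))))"
      unfolding c_def \<alpha>_def using elim by (intro expected_matches_bounds(2) assms(3)) auto
    also have "\<dots> \<le> c * ((real n)\<^sup>2 * exp (- (2 * \<alpha> * of_int (k n))))"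
      using elim c by (intro mult_left_mono mult_right_mono pair_count_le) auto
    finally show ?case using g elim by simp
  qed
  have nonneg: "\<forall>\<^sub>F n in sequentially. 0 \<le> ?e n"
    using assms(4)
  proof eventually_elim
    case (elim n)
    have "0 \<le> exp (- (16 * D)) * (of_int ((int n - k n + 1) * (int n - k n))
        * exp (- (2 * decay_rate U * of_int (k n))))"
      using elim by (intro mult_nonneg_nonneg) auto
    also have "\<dots> \<le> ?e n" using elim by (intro expected_matches_bounds(1) assms(3)) auto
    finally show ?case .
  qed
  \<comment> \<open>The critical length is logarithmic in \<open>n\<close>, so an upper bound on
    \<open>k n - critical_length U n\<close> forces \<open>k n \<le> n / 2\<close> eventually. At
    least \<open>n^2 / 4\<close> pairs of windows then remain, which is the source of the 4.\<close>
  have lower: "\<forall>\<^sub>F n in sequentially. g n / (4 * c) \<le> ?e n"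
    if B: "\<forall>\<^sub>F n in sequentially. of_int (k n) - critical_length U n \<le> B" for B
  proof -
    have "\<forall>\<^sub>F n in sequentially. ln (real n) / \<alpha> + B \<le> real n / 2"
      using \<alpha> by real_asymp
    with B assms(4) eventually_gt_at_top[of 0] show ?thesis
    proof eventually_elim
      case (elim n)
      then have half: "of_int (k n) \<le> real n / 2"
        by (simp add: critical_length_def \<alpha>_def)
      have "g n / (4 * c) = exp (- (16 * D)) * ((real n)\<^sup>2 / 4 * exp (- (2 * \<alpha> * of_int (k n))))"
        using g elim by (simp add: c_def exp_minus field_simps)
      also have "\<dots> \<le> exp (- (16 * D)) *
          (of_int ((int n - k n + 1) * (int n - k n)) * exp (- (2 * \<alpha> * of_int (k n))))"
        using half by (intro mult_left_mono mult_right_mono pair_count_ge) auto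
      also have "\<dots> \<le> ?e n"
        unfolding \<alpha>_def using elim by (intro expected_matches_bounds(1) assms(3)) auto
      finally show ?case .
    qed
  qed
  have "filterlim ?e at_top sequentially"
    if lim: "filterlim (\<lambda>n. critical_length U n - of_int (k n)) at_top sequentially"
  proof (rule filterlim_at_top_mono)
    have "filterlim g at_top sequentially"
      unfolding g_def using \<alpha>
      by (intro filterlim_compose[OF exp_at_top] filterlim_tendsto_pos_mult_at_top[OF tendsto_const _ lim]) simp
    then show "filterlim (\<lambda>n. g n / (4 * c)) at_top sequentially"
      using filterlim_tendsto_pos_mult_at_top[OF tendsto_const[of "1 / (4 * c)"]] c by simp
    have "\<forall>\<^sub>F n in sequentially. 0 \<le> critical_length U n - of_int (k n)"
      using lim unfolding filterlim_at_top by blast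
    \<comment> \<open>In this regime \<open>k n\<close> is eventually at most the critical length,
      so \<open>B = 0\<close> serves.\<close>
    then show "\<forall>\<^sub>F n in sequentially. g n / (4 * c) \<le> ?e n"
      by (intro lower[of 0]) (simp add: algebra_simps)
  qed
  moreover have "?e \<longlonglongrightarrow> 0"
    if lim: "filterlim (\<lambda>n. of_int (k n) - critical_length U n) at_top sequentially"
  \<comment> \<open>The expectation lies between 0 and \<open>c * g n\<close>, and the exponent in
    \<open>g n\<close> tends to minus infinity.\<close>
  proof (rule tendsto_sandwich[OF nonneg upper tendsto_const])
    have "filterlim (\<lambda>n. 2 * \<alpha> * (critical_length U n - of_int (k n))) at_bot sequentially"
      using filterlim_tendsto_pos_mult_at_top[OF tendsto_const _ lim, of "2 * \<alpha>"] \<alpha>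
      by (simp add: filterlim_uminus_at_top algebra_simps)
    then have "g \<longlonglongrightarrow> 0"
      unfolding g_def by (rule filterlim_compose[OF exp_at_bot])
    then show "(\<lambda>n. c * g n) \<longlonglongrightarrow> 0" by (rule tendsto_mult_right_zero)
  qed
  moreover have "0 < liminf (\<lambda>n. ereal (?e n)) \<and> liminf (\<lambda>n. ereal (?e n)) \<le> limsup (\<lambda>n. ereal (?e n))
      \<and> limsup (\<lambda>n. ereal (?e n)) < \<infinity>"
    if bdd: "Bseq (\<lambda>n. of_int (k n) - critical_length U n)"
  proof -
    obtain B where B: "\<And>n. \<bar>of_int (k n) - critical_length U n\<bar> \<le> B"
      using bdd by (auto simp: Bseq_def)
    \<comment> \<open>A bounded distance from the critical length confines \<open>g\<close> between
      two positive constants, and \<open>lower\<close> and \<open>upper\<close> pass this on to the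
      expectation.\<close>
    have gB: "exp (- (2 * \<alpha> * B)) \<le> g n" "g n \<le> exp (2 * \<alpha> * B)" for n
    proof -
      have "- B \<le> critical_length U n - of_int (k n)" "critical_length U n - of_int (k n) \<le> B"
        using B[of n] by linarith+
      then have "2 * \<alpha> * (- B) \<le> 2 * \<alpha> * (critical_length U n - of_int (k n))"
        "2 * \<alpha> * (critical_length U n - of_int (k n)) \<le> 2 * \<alpha> * B"
        using \<alpha> by (intro mult_left_mono; simp)+
      then show "exp (- (2 * \<alpha> * B)) \<le> g n" "g n \<le> exp (2 * \<alpha> * B)" by (simp_all add: g_def)
    qed
    have "\<forall>\<^sub>F n in sequentially. of_int (k n) - critical_length U n \<le> B"
      using B by (intro always_eventually allI) (metis abs_le_D1)
    then have "\<forall>\<^sub>F n in sequentially. g n / (4 * c) \<le> ?e n" by (rule lower)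
    then have "\<forall>\<^sub>F n in sequentially. ereal (exp (- (2 * \<alpha> * B)) / (4 * c)) \<le> ereal (?e n)"
    proof eventually_elim
      case (elim n)
      have "exp (- (2 * \<alpha> * B)) / (4 * c) \<le> g n / (4 * c)"
        using gB(1) c by (intro divide_right_mono) auto
      with elim show ?case by simp
    qed
    then have "ereal (exp (- (2 * \<alpha> * B)) / (4 * c)) \<le> liminf (\<lambda>n. ereal (?e n))"
      by (rule Liminf_bounded)
    moreover have "0 < ereal (exp (- (2 * \<alpha> * B)) / (4 * c))" using c by simp
    moreover have "\<forall>\<^sub>F n in sequentially. ereal (?e n) \<le> ereal (c * exp (2 * \<alpha> * B))"
      using upper
    proof eventually_elim
      case (elim n)
      have "c * g n \<le> c * exp (2 * \<alpha> * B)" using gB(2) c by (intro mult_left_mono) auto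
      with elim show ?case by simp
    qed
    then have "limsup (\<lambda>n. ereal (?e n)) \<le> ereal (c * exp (2 * \<alpha> * B))"
      by (rule Limsup_bounded)
    moreover have "ereal (c * exp (2 * \<alpha> * B)) < \<infinity>" by simp
    ultimately show ?thesis
      using Liminf_le_Limsup[OF sequentially_bot, of "\<lambda>n. ereal (?e n)"]
      by (metis less_le_trans le_less_trans)
  qed
  ultimately show ?thesis using \<alpha> by (simp add: \<alpha>_def)
qed

end
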